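(* Consider $n$ agents in $\mathbb{R}^2$ with positions $p_1(t),\dots,p_n(t)$, $t\ge 0$, visibility range $V>0$ and speed $\sigma>0$, moving according to $$\dot p_i(t)=\begin{cases}\sigma\,\hat p_{i_{bisector}}(t), & \psi_i(t)<\pi,\\ 0,&\text{otherwise,}\end{cases}\qquad \hat p_{i_{bisector}}(t)=\frac{\hat p_{i_R}(t)+\hat p_{i_L}(t)}{\|\hat p_{i_R}(t)+\hat p_{i_L}(t)\|},$$ with $\psi_i,\hat p_{i_R},\hat p_{i_L}$ as defined in the context. Then, for any initial constellation with a connected neighborhood graph, all the agents converge to a point in finite time: there are a finite $T$ and a point $q\in\mathbb{R}^2$ such that $p_i(T)=q$ for all $i$.
   Context: System $\mathcal{S}_7$ (finite visibility, bearing-only sensing, continuous time). Agent $j\ne i$ is a neighbour of agent $i$ at time $t$, $j\in N_i(t)$, iff $\|p_i(t)-p_j(t)\|<V$; the neighborhood graph has the agents as vertices and pairs of neighbours as edges. $p_{i_R}(t)$ and $p_{i_L}(t)$ are the positions of the extreme right and extreme left agents defining the minimal angular sector with apex $p_i(t)$ containing all neighbours of agent $i$; $\psi_i(t)=\angle p_{i_R}p_ip_{i_L}$ is the angle of this sector; $\hat p_{i_R}(t)=\frac{p_{i_R}(t)-p_i(t)}{\|p_{i_R}(t)-p_i(t)\|}$ and $\hat p_{i_L}(t)=\frac{p_{i_L}(t)-p_i(t)}{\|p_{i_L}(t)-p_i(t)\|}$. (If all neighbours lie in one direction, $\psi_i=0$ and $\hat p_{i_R}=\hat p_{i_L}$.)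 Agents located at the same position act as one agent: a collocated agent provides no bearing, and if all agents are at the same position they do not move. *)

theory Defs
  imports "HOL-Analysis.Analysis"
begin

text \<open>A configuration \<open>c\<close> assigns to each agent its position in the plane; the agents are
  the elements of an arbitrary finite type.\<close>

definition neighbours :: "real \<Rightarrow> ('n::finite \<Rightarrow> real^2) \<Rightarrow> 'n \<Rightarrow> 'n set" where
  "neighbours V c i = {j. j \<noteq> i \<and> norm (c i - c j) < V}"

text \<open>The edges are kept as a symmetric set of ordered pairs, so that the reflexive transitive
  closure is the existence of a path.\<close>

definition neighbourhood_edges :: "real \<Rightarrow> ('n::finite \<Rightarrow> real^2) \<Rightarrow> ('n \<times> 'n) set" where
  "neighbourhood_edges V c = {(i, j). j \<in> neighbours V c i}"

definition neighbourhood_connected :: "real \<Rightarrow> ('n::finite \<Rightarrow> real^2) \<Rightarrow> bool" where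
  "neighbourhood_connected V c \<longleftrightarrow> (\<forall>i j. (i, j) \<in> (neighbourhood_edges V c)\<^sup>*)"

definition dir :: "real \<Rightarrow> real^2" where
  "dir \<theta> = vector [cos \<theta>, sin \<theta>]"

text \<open>The closed sector with apex \<open>a\<close> swept counterclockwise from its right boundary ray, of
  direction \<open>dir \<alpha>\<close>, to its left boundary ray, of direction \<open>dir (\<alpha> + \<phi>)\<close>. It contains its apex,
  so a neighbour collocated with the apex imposes no constraint.\<close>

definition sector :: "real^2 \<Rightarrow> real \<Rightarrow> real \<Rightarrow> (real^2) set" where
  "sector a \<alpha> \<phi> = {a + r *\<^sub>R dir \<theta> | r \<theta>. 0 \<le> r \<and> \<alpha> \<le> \<theta> \<and> \<theta> \<le> \<alpha> + \<phi>}"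

text \<open>The angle \<open>\<psi>\<^sub>i\<close> of the minimal sector. The infimum is attained, since there are finitely
  many neighbours and \<open>\<alpha>\<close> matters only modulo \<open>2\<pi>\<close>.\<close>

definition sector_angle :: "real \<Rightarrow> ('n::finite \<Rightarrow> real^2) \<Rightarrow> 'n \<Rightarrow> real" where
  "sector_angle V c i =
     Inf {\<phi>. 0 \<le> \<phi> \<and> (\<exists>\<alpha>. c ` neighbours V c i \<subseteq> sector (c i) \<alpha> \<phi>)}"

definition visible :: "real \<Rightarrow> ('n::finite \<Rightarrow> real^2) \<Rightarrow> 'n \<Rightarrow> 'n set" where
  "visible V c i = {j \<in> neighbours V c i. c j \<noteq> c i}"

text \<open>Since \<open>sgn v = v /\<^sub>R norm v\<close>, this is the unit vector from agent \<open>i\<close> towards agent \<open>j\<close>.\<close>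

definition bearing :: "('n::finite \<Rightarrow> real^2) \<Rightarrow> 'n \<Rightarrow> 'n \<Rightarrow> real^2" where
  "bearing c i j = sgn (c j - c i)"

text \<open>The agents \<open>R\<close> and \<open>L\<close> lie on the right and on the left boundary ray of a minimal
  sector.\<close>

definition extreme_agents :: "real \<Rightarrow> ('n::finite \<Rightarrow> real^2) \<Rightarrow> 'n \<Rightarrow> 'n \<Rightarrow> 'n \<Rightarrow> bool" where
  "extreme_agents V c i R L \<longleftrightarrow>
     R \<in> visible V c i \<and> L \<in> visible V c i \<and>
     (\<exists>\<alpha>. c ` neighbours V c i \<subseteq> sector (c i) \<alpha> (sector_angle V c i) \<and>
          bearing c i R = dir \<alpha> \<and> bearing c i L = dir (\<alpha> + sector_angle V c i))"

text \<open>Whenever some neighbour is visible, extreme agents exist; if moreover \<open>\<psi>\<^sub>i < \<pi>\<close>, the minimal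
  sector is unique, so the two bearings do not depend on the choice made here.\<close>

definition bisector :: "real \<Rightarrow> ('n::finite \<Rightarrow> real^2) \<Rightarrow> 'n \<Rightarrow> real^2" where
  "bisector V c i =
     (case SOME (R, L). extreme_agents V c i R L of
        (R, L) \<Rightarrow> sgn (bearing c i R + bearing c i L))"

text \<open>An agent that sees no bearing at all does not move.\<close>

definition velocity :: "real \<Rightarrow> real \<Rightarrow> ('n::finite \<Rightarrow> real^2) \<Rightarrow> 'n \<Rightarrow> real^2" where
  "velocity V \<sigma> c i =
     (if visible V c i \<noteq> {} \<and> sector_angle V c i < pi then \<sigma> *\<^sub>R bisector V c i else 0)"

definition abs_continuous_on_interval ::
    "(real \<Rightarrow> 'a::real_normed_vector) \<Rightarrow> real \<Rightarrow> real \<Rightarrow> bool" where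
  "abs_continuous_on_interval f a b \<longleftrightarrow>
     (\<forall>\<epsilon>>0. \<exists>\<delta>>0. \<forall>D :: (real \<times> real) set.
        finite D \<and> (\<forall>(u, v)\<in>D. a \<le> u \<and> u \<le> v \<and> v \<le> b) \<and>
        pairwise (\<lambda>(u, v) (u', v'). {u<..<v} \<inter> {u'<..<v'} = {}) D \<and>
        (\<Sum>(u, v)\<in>D. v - u) < \<delta>
        \<longrightarrow> (\<Sum>(u, v)\<in>D. norm (f v - f u)) < \<epsilon>)"

text \<open>The right-hand side is discontinuous in the configuration, so already two approaching agents
  have no velocity at the instant they meet. Solutions are therefore understood in the sense of
  Caratheodory: absolutely continuous, with the differential equation at almost every time.
  This includes all continuous trajectories that satisfy the equation except at countably many
  instants.\<close>

definition trajectory :: "real \<Rightarrow> real \<Rightarrow> (real \<Rightarrow> 'n::finite \<Rightarrow> real^2) \<Rightarrow> bool" where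
  "trajectory V \<sigma> p \<longleftrightarrow>
     (\<forall>i. (\<forall>b\<ge>0. abs_continuous_on_interval (\<lambda>t. p t i) 0 b) \<and>
          (AE t in lebesgue. 0 \<le> t \<longrightarrow>
             ((\<lambda>s. p s i) has_vector_derivative velocity V \<sigma> (p t) i) (at t within {0..})))"

end

(* The truncated distances min V |p_i - p_j| are nonincreasing, because neighbours approach each
   other: every moving agent's velocity makes an angle of less than pi / 2 with the direction to
   each of its neighbours. Hence the graph stays connected. As long as the agents are not
   collocated, some agent has all the others in a sector of angle at most pi - pi / (n + 1), so
   its distance to a neighbour decreases at a rate bounded below in terms of sigma and n alone.
   The sum of the truncated distances is nonnegative, so this cannot go on forever. *)

theory Submission
  imports Defs
begin

text \<open>Two irregularities shape the proof. The equation holds only almost everywhere, so a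
  decrease has to be integrated across a null set of times about which nothing but absolute
  continuity is known. Moreover a truncated distance need not be differentiable where two agents
  meet or where a pair comes within range. The rate is therefore extracted from a single pair at a
  time, at a distance strictly between 0 and V; for all other pairs monotonicity suffices. For the
  same reason derivative bounds are stated as bounds on increments over short intervals around a
  given time.

  The angle pi - pi / (n + 1) comes from a pigeonhole argument with n + 1 directions. Interior
  angles of the convex hull would give a sharper bound, at the price of treating hulls and their
  degenerate cases; any bound below pi in terms of n alone is enough. That the rate does not depend
  on the distances is what gives a finite time instead of convergence in the limit.\<close>

section \<open>Unit vectors and polar angles\<close>

lemma inner_dir: "dir a \<bullet> dir b = cos (a - b)"
  by (simp add: dir_def inner_vec_def sum_2 cos_diff)

lemma norm_dir [simp]: "norm (dir a) = 1"
  by (simp add: norm_eq_sqrt_inner inner_dir)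

lemma dir_neq_0 [simp]: "dir a \<noteq> 0"
  using norm_dir[of a] by (metis norm_zero zero_neq_one)

lemma dir_eq_iff: "dir a = dir b \<longleftrightarrow> (\<exists>k::int. a = b + k * (2 * pi))"
proof -
  have "dir a = dir b \<longleftrightarrow> (dir a - dir b) \<bullet> (dir a - dir b) = 0"
    by simp
  also have "\<dots> \<longleftrightarrow> cos (a - b) = 1"
    by (simp add: inner_diff_left inner_diff_right inner_dir cos_diff)
      (auto simp: mult.commute)
  also have "\<dots> \<longleftrightarrow> (\<exists>k::int. a = b + k * (2 * pi))"
    by (simp add: cos_one_2pi_int) (metis add.commute diff_add_cancel add_diff_cancel_left' mult.assoc)
  finally show ?thesis .
qed

text \<open>The free choice of the window of length 2 pi allows angles to be compared as real
  numbers instead of modulo full turns.\<close>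

lemma exists_dir_above:
  obtains \<theta> where "x = norm x *\<^sub>R dir \<theta>" "a \<le> \<theta>" "\<theta> < a + 2 * pi"
proof -
  have "\<exists>\<theta>. x = norm x *\<^sub>R dir \<theta>"
  proof (cases "x = 0")
    case False
    let ?u = "x /\<^sub>R norm x"
    have "norm ?u = 1" using False by simp
    then have "(?u$1)\<^sup>2 + (?u$2)\<^sup>2 = 1"
      by (simp add: norm_vec_def L2_set_def sum_2)
    then obtain \<theta> where "?u$1 = cos \<theta>" "?u$2 = sin \<theta>"
      using sincos_total_2pi by metis
    then have "?u = dir \<theta>"
      by (simp add: dir_def vec_eq_iff forall_2)
    then have "x = norm x *\<^sub>R dir \<theta>"
      using False by (metis norm_eq_zero scaleR_one right_inverse scaleR_scaleR)
    then show ?thesis by blast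
  qed simp
  then obtain \<theta> where th: "x = norm x *\<^sub>R dir \<theta>" by blast
  define k where "k = \<lfloor>(\<theta> - a) / (2 * pi)\<rfloor>"
  let ?t = "\<theta> - k * (2 * pi)"
  have "k \<le> (\<theta> - a) / (2 * pi)" "(\<theta> - a) / (2 * pi) < k + 1"
    unfolding k_def by linarith+
  then have "k * (2 * pi) \<le> \<theta> - a" "\<theta> - a < (k + 1) * (2 * pi)"
    by (simp_all add: field_simps)
  moreover have "dir ?t = dir \<theta>"
    by (auto simp: dir_eq_iff intro!: exI[of _ "-k"])
  ultimately show ?thesis
    using that[of ?t] th by (simp add: algebra_simps)
qed

text \<open>The sum equals 2 cos (\<phi> / 2) times the unit vector halfway between the two, and
  this factor is positive because \<phi> < pi.\<close>

lemma sgn_dir_add_dir: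
  assumes "0 \<le> \<phi>" "\<phi> < pi"
  shows "sgn (dir \<alpha> + dir (\<alpha> + \<phi>)) = dir (\<alpha> + \<phi> / 2)"
proof -
  let ?m = "\<alpha> + \<phi> / 2" and ?h = "\<phi> / 2"
  have "dir (m - h) + dir (m + h) = (2 * cos h) *\<^sub>R dir m" for m h
    by (simp add: dir_def vec_eq_iff forall_2 cos_add sin_add cos_diff sin_diff)
  from this[of ?m ?h] have "dir \<alpha> + dir (\<alpha> + \<phi>) = (2 * cos ?h) *\<^sub>R dir ?m"
    by (simp add: add.commute)
  moreover have "cos ?h > 0"
    using assms by (intro cos_gt_zero_pi) auto
  ultimately show ?thesis
    by (simp add: sgn_scaleR) (simp add: sgn_div_norm)
qed

section \<open>The minimal sector and the velocity it determines\<close>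

lemma sector_angle_le:
  assumes "0 \<le> \<phi>" "c ` neighbours V c i \<subseteq> sector (c i) \<alpha> \<phi>"
  shows "sector_angle V c i \<le> \<phi>"
  unfolding sector_angle_def
  by (rule cInf_lower) (use assms in \<open>auto intro: bdd_belowI[of _ 0]\<close>)

lemma apex_in_sector: "0 \<le> \<phi> \<Longrightarrow> a \<in> sector a \<alpha> \<phi>"
  by (auto simp: sector_def intro!: exI[of _ 0] exI[of _ \<alpha>])

text \<open>An infimum below pi provides a sector of angle below pi around all neighbours, so their
  directions lift to real angles in an interval shorter than pi. The visible agents of least and
  greatest angle span a sector of angle \<open>\<psi>\<close>, and no competing sector is narrower.
  This guarantees that the choice in \<open>bisector\<close> picks a genuine pair.\<close>

lemma ex_extreme_agents:
  fixes c :: "'n::finite \<Rightarrow> real^2"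
  assumes vis: "visible V c i \<noteq> {}" and "sector_angle V c i < pi"
  shows "0 \<le> sector_angle V c i \<and> (\<exists>R L. extreme_agents V c i R L)"
proof -
  let ?S = "{\<phi>. 0 \<le> \<phi> \<and> (\<exists>\<alpha>. c ` neighbours V c i \<subseteq> sector (c i) \<alpha> \<phi>)}"
  let ?W = "visible V c i"
  have ne: "?S \<noteq> {}"
  proof -
    have "x \<in> sector (c i) 0 (2 * pi)" for x
    proof -
      obtain \<theta> where "x - c i = norm (x - c i) *\<^sub>R dir \<theta>" "0 \<le> \<theta>" "\<theta> < 0 + 2 * pi"
        by (rule exists_dir_above)
      then have "x = c i + norm (x - c i) *\<^sub>R dir \<theta>" "0 \<le> \<theta>" "\<theta> \<le> 0 + 2 * pi"
        by (auto simp: algebra_simps)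
      then show ?thesis
        unfolding sector_def mem_Collect_eq using norm_ge_zero by blast
    qed
    then have "2 * pi \<in> ?S"
      by (auto intro!: exI[of _ 0])
    then show ?thesis by blast
  qed
  obtain \<phi> \<alpha> where \<phi>: "\<phi> < pi" "0 \<le> \<phi>" "c ` neighbours V c i \<subseteq> sector (c i) \<alpha> \<phi>"
    using cInf_lessD[OF ne, of pi] assms unfolding sector_angle_def by auto
  have "\<forall>j\<in>?W. \<exists>\<theta>. c j - c i = norm (c j - c i) *\<^sub>R dir \<theta> \<and> \<alpha> \<le> \<theta> \<and> \<theta> \<le> \<alpha> + \<phi>"
  proof
    fix j assume "j \<in> ?W"
    then have "c j \<in> sector (c i) \<alpha> \<phi>" using \<phi> by (auto simp: visible_def)
    then obtain r \<theta> where r: "c j = c i + r *\<^sub>R dir \<theta>" "0 \<le> r" "\<alpha> \<le> \<theta>" "\<theta> \<le> \<alpha> + \<phi>"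
      unfolding sector_def by blast
    then have "norm (c j - c i) = r" by simp
    then show "\<exists>\<theta>. c j - c i = norm (c j - c i) *\<^sub>R dir \<theta> \<and> \<alpha> \<le> \<theta> \<and> \<theta> \<le> \<alpha> + \<phi>"
      using r by auto
  qed
  then obtain \<theta> where th: "\<And>j. j \<in> ?W \<Longrightarrow>
      c j - c i = norm (c j - c i) *\<^sub>R dir (\<theta> j) \<and> \<alpha> \<le> \<theta> j \<and> \<theta> j \<le> \<alpha> + \<phi>"
    by metis
  have bearing: "bearing c i j = dir (\<theta> j)" if "j \<in> ?W" for j
  proof -
    have "norm (c j - c i) > 0" using that by (auto simp: visible_def)
    moreover have "sgn (c j - c i) = sgn (norm (c j - c i) *\<^sub>R dir (\<theta> j))"
      using th[OF that] by metis
    ultimately show ?thesis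
      unfolding bearing_def by (simp add: sgn_scaleR) (simp add: sgn_div_norm)
  qed
  have fin: "finite (\<theta> ` ?W)" "\<theta> ` ?W \<noteq> {}" using vis by auto
  obtain R where R: "R \<in> ?W" "\<And>j. j \<in> ?W \<Longrightarrow> \<theta> R \<le> \<theta> j"
    using Min_in[OF fin] Min_le[OF fin(1)] by (metis (no_types, lifting) image_iff)
  obtain L where L: "L \<in> ?W" "\<And>j. j \<in> ?W \<Longrightarrow> \<theta> j \<le> \<theta> L"
    using Max_in[OF fin] Max_ge[OF fin(1)] by (metis (no_types, lifting) image_iff)
  define \<psi> where "\<psi> = \<theta> L - \<theta> R"
  have \<psi>: "0 \<le> \<psi>" "\<psi> < pi"
    using R(2)[OF L(1)] th[OF R(1)] th[OF L(1)] \<phi> unfolding \<psi>_def by auto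
  have sub: "c ` neighbours V c i \<subseteq> sector (c i) (\<theta> R) \<psi>"
  proof clarify
    fix j assume j: "j \<in> neighbours V c i"
    show "c j \<in> sector (c i) (\<theta> R) \<psi>"
    proof (cases "c j = c i")
      case True
      then show ?thesis using apex_in_sector \<psi>(1) by simp
    next
      case False
      then have "j \<in> ?W" using j by (simp add: visible_def)
      then have "c j = c i + norm (c j - c i) *\<^sub>R dir (\<theta> j) \<and> \<theta> R \<le> \<theta> j \<and> \<theta> j \<le> \<theta> R + \<psi>"
        using th[of j] R(2) L(2) unfolding \<psi>_def by (auto simp: algebra_simps)
      then show ?thesis
        unfolding sector_def mem_Collect_eq using norm_ge_zero by blast
    qed
  qed
  have "\<psi> \<le> \<phi>'" if "\<phi>' \<in> ?S" for \<phi>'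
  \<comment> \<open>Only competitors narrower than pi matter, since \<open>\<psi>\<close> is itself
    below pi.\<close>
  proof (cases "\<phi>' < pi")
    case True
    from that obtain \<beta> where \<beta>: "c ` neighbours V c i \<subseteq> sector (c i) \<beta> \<phi>'" by blast
    have angle: "\<exists>x. dir (\<theta> j) = dir x \<and> \<beta> \<le> x \<and> x \<le> \<beta> + \<phi>'" if "j \<in> ?W" for j
    proof -
      have j: "c j \<noteq> c i" "c j \<in> c ` neighbours V c i" using that by (auto simp: visible_def)
      obtain r x where r: "c j = c i + r *\<^sub>R dir x" "0 \<le> r" "\<beta> \<le> x" "x \<le> \<beta> + \<phi>'"
        using subsetD[OF \<beta> j(2)] unfolding sector_def by blast
      then have "r > 0" using j(1) by (cases "r = 0") auto
      then have "bearing c i j = dir x"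
        unfolding bearing_def using r(1) by (simp add: sgn_scaleR) (simp add: sgn_div_norm)
      then show ?thesis using bearing[OF that] r by metis
    qed
    obtain x where x: "dir (\<theta> R) = dir x" "\<beta> \<le> x" "x \<le> \<beta> + \<phi>'" using angle[OF R(1)] by blast
    obtain y where y: "dir (\<theta> L) = dir y" "\<beta> \<le> y" "y \<le> \<beta> + \<phi>'" using angle[OF L(1)] by blast
    obtain k l :: int where "\<theta> R = x + k * (2 * pi)" "\<theta> L = y + l * (2 * pi)"
      using x(1) y(1) unfolding dir_eq_iff by blast
    then have e: "\<psi> = y - x + of_int (l - k) * (2 * pi)"
      unfolding \<psi>_def by (simp add: algebra_simps)
    \<comment> \<open>Both \<open>\<psi>\<close> and \<open>y - x\<close> have modulus below pi, so
      they cannot differ by a nonzero number of full turns.\<close>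
    then have "\<bar>of_int (l - k) * (2 * pi)\<bar> < 1 * (2 * pi)"
      using \<psi> x y True by linarith
    then have "\<bar>real_of_int (l - k)\<bar> < 1"
      unfolding abs_mult by (simp del: of_int_diff)
    then have "l - k = 0" by linarith
    then show ?thesis using e x y by simp
  qed (use \<psi> in simp)
  then have "\<psi> \<le> sector_angle V c i"
    unfolding sector_angle_def by (intro cInf_greatest[OF ne])
  then have eq: "sector_angle V c i = \<psi>"
    using sector_angle_le[OF \<psi>(1) sub] by simp
  have "\<theta> R + \<psi> = \<theta> L" by (simp add: \<psi>_def)
  then have "extreme_agents V c i R L"
    unfolding extreme_agents_def eq using R(1) L(1) sub bearing by metis
  then show ?thesis using eq \<psi> by blast
qed

text \<open>Whichever extreme pair is chosen, \<open>extreme_agents\<close> comes with a sector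
  whose boundary rays pass through that pair, so the normalized sum of the two bearings is the
  bisector of this very sector.\<close>

lemma velocity_towards_sector:
  fixes c :: "'n::finite \<Rightarrow> real^2"
  assumes "visible V c i \<noteq> {}" "sector_angle V c i < pi"
  obtains \<alpha> where "velocity V \<sigma> c i = \<sigma> *\<^sub>R dir (\<alpha> + sector_angle V c i / 2)"
    "c ` neighbours V c i \<subseteq> sector (c i) \<alpha> (sector_angle V c i)"
proof -
  let ?RL = "SOME (R, L). extreme_agents V c i R L"
  have "case ?RL of (R, L) \<Rightarrow> extreme_agents V c i R L"
    using ex_extreme_agents[OF assms] by (intro someI_ex[where P = "\<lambda>(R, L). extreme_agents V c i R L"]) auto
  then obtain R L where RL: "?RL = (R, L)" "extreme_agents V c i R L"
    by (cases ?RL) auto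
  then obtain \<alpha> where "c ` neighbours V c i \<subseteq> sector (c i) \<alpha> (sector_angle V c i)"
    "bearing c i R = dir \<alpha>" "bearing c i L = dir (\<alpha> + sector_angle V c i)"
    unfolding extreme_agents_def by blast
  then show ?thesis
    using that[of \<alpha>] RL assms ex_extreme_agents[OF assms]
    by (simp add: velocity_def bisector_def sgn_dir_add_dir)
qed

text \<open>The direction to any neighbour deviates from the bisector by at most half the sector
  angle, and cosine decreases on [0, pi]. For a collocated neighbour both sides vanish.\<close>

lemma velocity_inner_ge:
  fixes c :: "'n::finite \<Rightarrow> real^2"
  assumes "\<sigma> \<ge> 0" "visible V c i \<noteq> {}" "sector_angle V c i < pi" "j \<in> neighbours V c i"
  shows "velocity V \<sigma> c i \<bullet> (c j - c i) \<ge> \<sigma> * cos (sector_angle V c i / 2) * norm (c j - c i)"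
proof -
  let ?\<psi> = "sector_angle V c i"
  obtain \<alpha> where v: "velocity V \<sigma> c i = \<sigma> *\<^sub>R dir (\<alpha> + ?\<psi> / 2)"
    and s: "c ` neighbours V c i \<subseteq> sector (c i) \<alpha> ?\<psi>"
    using velocity_towards_sector[OF assms(2,3)] by blast
  obtain r \<theta> where r: "c j = c i + r *\<^sub>R dir \<theta>" "0 \<le> r" "\<alpha> \<le> \<theta>" "\<theta> \<le> \<alpha> + ?\<psi>"
    using s assms(4) unfolding sector_def by blast
  have "\<bar>\<alpha> + ?\<psi> / 2 - \<theta>\<bar> \<le> ?\<psi> / 2"
    unfolding abs_le_iff using r(3,4) by (simp add: field_simps)
  then have "cos (?\<psi> / 2) \<le> cos \<bar>\<alpha> + ?\<psi> / 2 - \<theta>\<bar>"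
    using assms(3) pi_gt_zero by (intro cos_monotone_0_pi_le) (auto simp: field_simps)
  then have "\<sigma> * r * cos (?\<psi> / 2) \<le> \<sigma> * r * cos (\<alpha> + ?\<psi> / 2 - \<theta>)"
    using assms(1) r(2) by (intro mult_left_mono) auto
  then show ?thesis
    using r v by (simp add: inner_dir algebra_simps)
qed

lemma velocity_inner_nonneg:
  fixes c :: "'n::finite \<Rightarrow> real^2"
  assumes "\<sigma> \<ge> 0" "j \<in> neighbours V c i"
  shows "velocity V \<sigma> c i \<bullet> (c j - c i) \<ge> 0"
proof (cases "visible V c i \<noteq> {} \<and> sector_angle V c i < pi")
  case True
  then have "cos (sector_angle V c i / 2) \<ge> 0"
    using ex_extreme_agents[of V c i] by (intro cos_ge_zero) auto
  then have "0 \<le> \<sigma> * cos (sector_angle V c i / 2) * norm (c j - c i)"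
    using assms by simp
  then show ?thesis
    using velocity_inner_ge[of \<sigma> V c i j] True assms by linarith
qed (auto simp: velocity_def)

lemma neighbours_sym: "j \<in> neighbours V c i \<longleftrightarrow> i \<in> neighbours V c j"
  by (auto simp: neighbours_def norm_minus_commute)

text \<open>The distance of two agents is not differentiable in general where they meet. Equal
  velocities make the derivative of the difference vanish there, which restores a derivative of the
  distance, namely 0.\<close>

lemma velocity_collocated:
  fixes c :: "'n::finite \<Rightarrow> real^2"
  assumes "c i = c j" "V > 0"
  shows "velocity V \<sigma> c i = velocity V \<sigma> c j"
proof (cases "i = j")
  case False
  \<comment> \<open>The two neighbourhoods differ as sets of agents, since neither agent is its own
    neighbour. Their images agree: the collocated partner \<open>k\<close> puts the apex into the
    image, which thus consists of all occupied positions within range.\<close>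
  have im: "c ` neighbours V c i = {x \<in> range c. norm (c i - x) < V}"
    if "k \<noteq> i" "c k = c i" for i k
  proof -
    have "c i \<in> c ` neighbours V c i"
      using that assms(2) by (intro image_eqI[of _ _ k]) (auto simp: neighbours_def)
    then show ?thesis by (auto simp: neighbours_def)
  qed
  have image: "c ` neighbours V c i = c ` neighbours V c j"
    using im[of i j] im[of j i] False assms(1) by simp
  have visible: "visible V c i = visible V c j"
    using assms(1) by (auto simp: visible_def neighbours_def)
  have angle: "sector_angle V c i = sector_angle V c j"
    using image assms(1) by (simp add: sector_angle_def)
  \<comment> \<open>Since the predicates are equal as functions, the choice operator returns the
    same pair for both agents.\<close>
  have "extreme_agents V c i = extreme_agents V c j" "bearing c i = bearing c j"
    using image visible angle assms(1) by (auto simp: extreme_agents_def bearing_def fun_eq_iff)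
  then show ?thesis
    using visible angle by (simp add: velocity_def bisector_def)
qed simp

section \<open>An approach speed bounded below in terms of \<sigma> and n\<close>

text \<open>Among the directions \<open>k \<pi> / (n + 1)\<close>, \<open>k = 0, \<dots>, n\<close>, two share an agent that is extreme
  in both; as these directions are neither equal nor opposite, the two supporting half-planes at
  that agent intersect in a pointed cone.\<close>

lemma ex_agent_sector_le:
  fixes c :: "'n::finite \<Rightarrow> real^2"
  obtains s \<alpha> \<phi> where "range c \<subseteq> sector (c s) \<alpha> \<phi>" "0 \<le> \<phi>" "\<phi> \<le> pi - pi / (CARD('n) + 1)"
proof -
  define n where "n = CARD('n)"
  define a where "a k = real k * (pi / (n + 1))" for k
  have "\<exists>i. \<forall>j. c j \<bullet> dir (a k) \<le> c i \<bullet> dir (a k)" for k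
  proof -
    let ?A = "range (\<lambda>i. c i \<bullet> dir (a k))"
    have "Max ?A \<in> ?A" by (intro Max_in) auto
    then obtain i where "Max ?A = c i \<bullet> dir (a k)" by blast
    then show ?thesis by (metis Max_ge finite finite_imageI rangeI)
  qed
  then obtain s where s: "\<And>k j. c j \<bullet> dir (a k) \<le> c (s k) \<bullet> dir (a k)" by metis
  have "\<not> inj_on s {..n}"
  proof
    assume "inj_on s {..n}"
    then have "card {..n} \<le> CARD('n)" by (intro card_inj_on_le[of s]) auto
    then show False by (simp add: n_def)
  qed
  then obtain k l where kl: "k < l" "l \<le> n" "s k = s l"
    unfolding inj_on_def by (metis atMost_iff linorder_neqE_nat)
  let ?d = "a l - a k"
  have "?d = (real l - real k) * (pi / (n + 1))" unfolding a_def by (rule left_diff_distrib[symmetric])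
  moreover have "1 * (pi / (n + 1)) \<le> (real l - real k) * (pi / (n + 1))"
    using kl by (intro mult_right_mono) auto
  moreover have "(real l - real k) * (pi / (n + 1)) < (n + 1) * (pi / (n + 1))"
    using kl by (intro mult_strict_right_mono) auto
  moreover have "(n + 1) * (pi / (n + 1)) = pi" by simp
  ultimately have d: "pi / (n + 1) \<le> ?d" "?d < pi" by linarith+
  \<comment> \<open>The two half-planes confine the angle to [a k + pi / 2, a k + 3 pi / 2] and to
    [a l + pi / 2, a l + 3 pi / 2]. The intersection starts at a l + pi / 2 and has length pi - (a l
    - a k).\<close>
  have "c j \<in> sector (c (s k)) (a l + pi / 2) (pi - ?d)" for j
  proof -
    let ?w = "c j - c (s k)"
    obtain \<theta> where th: "?w = norm ?w *\<^sub>R dir \<theta>" "a k + pi / 2 \<le> \<theta>" "\<theta> < a k + pi / 2 + 2 * pi"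
      by (rule exists_dir_above)
    show ?thesis
    proof (cases "?w = 0")
      case True
      then show ?thesis using apex_in_sector d by simp
    next
      case False
      have "?w \<bullet> dir (a m) = norm ?w * cos (\<theta> - a m)" for m
        using th(1) by (metis inner_dir inner_scaleR_left)
      moreover have "?w \<bullet> dir (a k) \<le> 0" "?w \<bullet> dir (a l) \<le> 0"
        using s[of j k] s[of j l] kl by (auto simp: inner_diff_left)
      moreover have "norm ?w > 0" using False by simp
      ultimately have cos: "cos (\<theta> - a k) \<le> 0" "cos (\<theta> - a l) \<le> 0"
        by (auto simp: mult_le_0_iff)
      have 1: "\<theta> \<le> a k + 3 * pi / 2"
      proof (rule ccontr)
        assume "\<not> ?thesis"
        then have "cos (\<theta> - a k - 2 * pi) > 0"
          using th by (intro cos_gt_zero_pi) auto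
        then show False using cos by (simp add: cos_diff)
      qed
      have 2: "a l + pi / 2 \<le> \<theta>"
      proof (rule ccontr)
        assume "\<not> ?thesis"
        \<comment> \<open>The window for \<theta> starts at a k + pi / 2, which exceeds a l - pi / 2
          because the two directions differ by less than pi.\<close>
        then have "cos (\<theta> - a l) > 0"
          using th d by (intro cos_gt_zero_pi) auto
        then show False using cos by simp
      qed
      have "c j = c (s k) + norm ?w *\<^sub>R dir \<theta>" using th(1) by (simp add: algebra_simps)
      moreover have "\<theta> \<le> a l + pi / 2 + (pi - ?d)" using 1 by simp
      ultimately show ?thesis
        using 2 unfolding sector_def mem_Collect_eq using norm_ge_zero by blast
    qed
  qed
  then show ?thesis
    using that[of "s k" "a l + pi / 2" "pi - ?d"] d unfolding n_def by (auto simp: add.commute)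
qed

text \<open>If s sees no bearing, every agent within range of s is collocated with it. Collocation
  then spreads along paths, since a neighbour of an agent at the position of s is within range of
  s.\<close>

lemma visible_nonempty:
  fixes c :: "'n::finite \<Rightarrow> real^2"
  assumes "neighbourhood_connected V c" "\<not> (\<exists>q. \<forall>i. c i = q)"
  shows "visible V c s \<noteq> {}"
proof
  assume e: "visible V c s = {}"
  have "c m = c s" if "(s, m) \<in> (neighbourhood_edges V c)\<^sup>*" for m
    using that
  proof induction
    case (step k m)
    then have "norm (c s - c m) < V" by (auto simp: neighbourhood_edges_def neighbours_def)
    then show ?case using e by (auto simp: visible_def neighbours_def)
  qed simp
  then show False using assms by (metis neighbourhood_connected_def)
qed

text \<open>An agent that has all others in a narrow sector has in particular its neighbours there.
  The estimate is divided by the distance to \<open>r\<close>, so the approach speed does not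
  degrade as the two agents get close.\<close>

lemma ex_fast_agent:
  fixes c :: "'n::finite \<Rightarrow> real^2"
  assumes "neighbourhood_connected V c" "\<not> (\<exists>q. \<forall>i. c i = q)" "\<sigma> > 0"
  obtains s r where "r \<in> visible V c s"
    "velocity V \<sigma> c s \<bullet> bearing c s r \<ge> \<sigma> * cos ((pi - pi / (CARD('n) + 1)) / 2)"
proof -
  let ?\<Phi> = "pi - pi / (CARD('n) + 1)"
  obtain s \<alpha> \<phi> where s: "range c \<subseteq> sector (c s) \<alpha> \<phi>" "0 \<le> \<phi>" "\<phi> \<le> ?\<Phi>"
    by (rule ex_agent_sector_le)
  have le: "sector_angle V c s \<le> ?\<Phi>"
    using sector_angle_le[of \<phi> c V s \<alpha>] s by fastforce
  have "?\<Phi> < pi" by (simp add: add_pos_pos)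
  then have lt: "sector_angle V c s < pi" using le by linarith
  obtain r where r: "r \<in> visible V c s"
    using visible_nonempty[OF assms(1,2)] by blast
  have pos: "norm (c r - c s) > 0" using r by (auto simp: visible_def)
  have "cos (?\<Phi> / 2) \<le> cos (sector_angle V c s / 2)"
  proof (rule cos_monotone_0_pi_le)
    show "0 \<le> sector_angle V c s / 2" using ex_extreme_agents[of V c s] r lt by auto
    have "x / 2 \<le> pi" if "x < pi" for x
      using that pi_gt_zero by linarith
    then show "?\<Phi> / 2 \<le> pi" using \<open>?\<Phi> < pi\<close> by blast
  qed (use le in simp)
  then have "\<sigma> * cos (?\<Phi> / 2) \<le> \<sigma> * cos (sector_angle V c s / 2)"
    using assms(3) by simp
  also have "\<dots> = \<sigma> * cos (sector_angle V c s / 2) * norm (c r - c s) / norm (c r - c s)"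
    using pos by simp
  also have "\<dots> \<le> velocity V \<sigma> c s \<bullet> (c r - c s) / norm (c r - c s)"
    using velocity_inner_ge[of \<sigma> V c s r] r lt assms(3)
    by (intro divide_right_mono) (auto simp: visible_def)
  also have "\<dots> = velocity V \<sigma> c s \<bullet> bearing c s r"
    by (simp add: bearing_def sgn_div_norm divide_inverse mult.commute)
  finally show ?thesis using that r by blast
qed

section \<open>Absolute continuity\<close>

text \<open>One comparison of increments serves for restriction to subintervals, for negation, and
  for the passage from a difference of positions to its norm or truncated norm.\<close>

lemma abs_continuous_on_interval_diff_le:
  fixes f :: "real \<Rightarrow> 'a::real_normed_vector" and g :: "real \<Rightarrow> 'b::real_normed_vector"
  assumes "abs_continuous_on_interval g a b" "a \<le> a'" "b' \<le> b"
    and le: "\<And>u v. a' \<le> u \<Longrightarrow> u \<le> v \<Longrightarrow> v \<le> b' \<Longrightarrow> norm (f v - f u) \<le> norm (g v - g u)"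
  shows "abs_continuous_on_interval f a' b'"
  unfolding abs_continuous_on_interval_def
proof (intro allI impI)
  fix \<epsilon> :: real assume "\<epsilon> > 0"
  then obtain \<delta> where "\<delta> > 0" and \<delta>: "\<forall>D. finite D \<and> (\<forall>(u, v)\<in>D. a \<le> u \<and> u \<le> v \<and> v \<le> b) \<and>
        pairwise (\<lambda>(u, v) (u', v'). {u<..<v} \<inter> {u'<..<v'} = {}) D \<and>
        (\<Sum>(u, v)\<in>D. v - u) < \<delta> \<longrightarrow> (\<Sum>(u, v)\<in>D. norm (g v - g u)) < \<epsilon>"
    using assms(1) unfolding abs_continuous_on_interval_def by blast
  show "\<exists>\<delta>>0. \<forall>D. finite D \<and> (\<forall>(u, v)\<in>D. a' \<le> u \<and> u \<le> v \<and> v \<le> b') \<and>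
        pairwise (\<lambda>(u, v) (u', v'). {u<..<v} \<inter> {u'<..<v'} = {}) D \<and>
        (\<Sum>(u, v)\<in>D. v - u) < \<delta> \<longrightarrow> (\<Sum>(u, v)\<in>D. norm (f v - f u)) < \<epsilon>"
  proof (intro exI[of _ \<delta>] conjI allI impI \<open>\<delta> > 0\<close>)
    fix D :: "(real \<times> real) set"
    assume D: "finite D \<and> (\<forall>(u, v)\<in>D. a' \<le> u \<and> u \<le> v \<and> v \<le> b') \<and>
        pairwise (\<lambda>(u, v) (u', v'). {u<..<v} \<inter> {u'<..<v'} = {}) D \<and> (\<Sum>(u, v)\<in>D. v - u) < \<delta>"
    have "(\<Sum>(u, v)\<in>D. norm (f v - f u)) \<le> (\<Sum>(u, v)\<in>D. norm (g v - g u))"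
      using D le by (intro sum_mono) auto
    moreover have "\<forall>(u, v)\<in>D. a \<le> u \<and> u \<le> v \<and> v \<le> b"
      using D assms(2,3) by fastforce
    ultimately show "(\<Sum>(u, v)\<in>D. norm (f v - f u)) < \<epsilon>"
      using \<delta>[rule_format, of D] D by linarith
  qed
qed

lemma abs_continuous_on_interval_add:
  fixes f g :: "real \<Rightarrow> 'a::real_normed_vector"
  assumes "abs_continuous_on_interval f a b" "abs_continuous_on_interval g a b"
  shows "abs_continuous_on_interval (\<lambda>t. f t + g t) a b"
  unfolding abs_continuous_on_interval_def
proof (intro allI impI)
  let ?P = "\<lambda>D \<delta>. finite D \<and> (\<forall>(u, v)\<in>D. a \<le> u \<and> u \<le> v \<and> v \<le> b) \<and>
        pairwise (\<lambda>(u, v) (u', v'). {u<..<v} \<inter> {u'<..<v'} = {}) D \<and> (\<Sum>(u, v)\<in>D. v - u) < \<delta>"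
  fix \<epsilon> :: real assume "\<epsilon> > 0"
  then have "\<epsilon> / 2 > 0" by simp
  obtain \<delta> where \<delta>: "\<delta> > 0" "\<forall>D. ?P D \<delta> \<longrightarrow> (\<Sum>(u, v)\<in>D. norm (f v - f u)) < \<epsilon> / 2"
    using assms(1) \<open>\<epsilon> / 2 > 0\<close> unfolding abs_continuous_on_interval_def by blast
  obtain \<delta>' where \<delta>': "\<delta>' > 0" "\<forall>D. ?P D \<delta>' \<longrightarrow> (\<Sum>(u, v)\<in>D. norm (g v - g u)) < \<epsilon> / 2"
    using assms(2) \<open>\<epsilon> / 2 > 0\<close> unfolding abs_continuous_on_interval_def by blast
  show "\<exists>\<delta>>0. \<forall>D. ?P D \<delta> \<longrightarrow> (\<Sum>(u, v)\<in>D. norm (f v + g v - (f u + g u))) < \<epsilon>"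
  proof (intro exI[of _ "min \<delta> \<delta>'"] conjI allI impI)
    fix D assume D: "?P D (min \<delta> \<delta>')"
    have "(\<Sum>(u, v)\<in>D. norm (f v + g v - (f u + g u)))
        \<le> (\<Sum>(u, v)\<in>D. norm (f v - f u) + norm (g v - g u))"
    proof (intro sum_mono, clarify)
      fix u v
      show "norm (f v + g v - (f u + g u)) \<le> norm (f v - f u) + norm (g v - g u)"
        by (metis add_diff_add norm_triangle_ineq)
    qed
    also have "\<dots> = (\<Sum>(u, v)\<in>D. norm (f v - f u)) + (\<Sum>(u, v)\<in>D. norm (g v - g u))"
      by (simp add: sum.distrib case_prod_unfold)
    also have "\<dots> < \<epsilon> / 2 + \<epsilon> / 2"
      using D \<delta>(2) \<delta>'(2) by (intro add_strict_mono) auto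
    finally show "(\<Sum>(u, v)\<in>D. norm (f v + g v - (f u + g u))) < \<epsilon>" by simp
  qed (use \<delta> \<delta>' in auto)
qed

lemma abs_continuous_on_interval_diff:
  fixes f g :: "real \<Rightarrow> 'a::real_normed_vector"
  assumes "abs_continuous_on_interval f a b" "abs_continuous_on_interval g a b"
  shows "abs_continuous_on_interval (\<lambda>t. f t - g t) a b"
proof -
  have "abs_continuous_on_interval (\<lambda>t. - g t) a b"
    by (rule abs_continuous_on_interval_diff_le[OF assms(2)]) (auto simp: norm_minus_commute)
  from abs_continuous_on_interval_add[OF assms(1) this] show ?thesis by simp
qed

lemma abs_continuous_on_interval_sum:
  fixes f :: "'i \<Rightarrow> real \<Rightarrow> 'a::real_normed_vector"
  assumes "\<And>i. i \<in> I \<Longrightarrow> abs_continuous_on_interval (f i) a b"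
  shows "abs_continuous_on_interval (\<lambda>t. \<Sum>i\<in>I. f i t) a b"
  using assms
proof (induction I rule: infinite_finite_induct)
  case (insert i I)
  then show ?case by (simp add: abs_continuous_on_interval_add)
qed (auto simp: abs_continuous_on_interval_def split_def intro: exI[of _ 1])

lemma abs_continuous_on_interval_imp_continuous_on:
  assumes "abs_continuous_on_interval f a b"
  shows "continuous_on {a..b} f"
  unfolding continuous_on_iff
proof (intro ballI allI impI)
  fix x \<epsilon> :: real assume x: "x \<in> {a..b}" and "\<epsilon> > 0"
  then obtain \<delta> where "\<delta> > 0" and \<delta>: "\<forall>D. finite D \<and> (\<forall>(u, v)\<in>D. a \<le> u \<and> u \<le> v \<and> v \<le> b) \<and>
        pairwise (\<lambda>(u, v) (u', v'). {u<..<v} \<inter> {u'<..<v'} = {}) D \<and>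
        (\<Sum>(u, v)\<in>D. v - u) < \<delta> \<longrightarrow> (\<Sum>(u, v)\<in>D. norm (f v - f u)) < \<epsilon>"
    using assms unfolding abs_continuous_on_interval_def by blast
  have "dist (f y) (f x) < \<epsilon>" if "y \<in> {a..b}" "dist y x < \<delta>" for y
    using \<delta>[rule_format, of "{(min x y, max x y)}"] that x
    by (cases "x \<le> y") (auto simp: dist_norm norm_minus_commute pairwise_def)
  then show "\<exists>d>0. \<forall>y\<in>{a..b}. dist y x < d \<longrightarrow> dist (f y) (f x) < \<epsilon>"
    using \<open>\<delta> > 0\<close> by blast
qed

section \<open>From pointwise derivative bounds to increments\<close>

text \<open>The condition on \<open>u \<le> t \<le> v\<close> bounds both upper Dini derivatives at \<open>t\<close> by \<open>K\<close>. On a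
  sufficiently fine tagged division, the intervals tagged in the null set \<open>N\<close> have small total
  length, so that absolute continuity controls their contribution.\<close>

lemma abs_continuous_increment_le:
  fixes f :: "real \<Rightarrow> real"
  assumes ac: "abs_continuous_on_interval f a b" and "a \<le> b" and N: "negligible N"
    and straddle: "\<And>t \<epsilon>. t \<in> {a..b} \<Longrightarrow> t \<notin> N \<Longrightarrow> \<epsilon> > 0 \<Longrightarrow> \<exists>\<delta>>0. \<forall>u v. a \<le> u \<longrightarrow> u \<le> t \<longrightarrow> t \<le> v \<longrightarrow>
        v \<le> b \<longrightarrow> t - u < \<delta> \<longrightarrow> v - t < \<delta> \<longrightarrow> f v - f u \<le> (K + \<epsilon>) * (v - u)"
  shows "f b - f a \<le> K * (b - a)"
proof (rule field_le_epsilon)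
  fix e :: real assume "e > 0"
  \<comment> \<open>The final error is at most \<epsilon> (b - a) from the good tags, |K| \<epsilon>
    from the length they fail to cover, and \<epsilon> from the tags in \<open>N\<close>; these add
    up to e.\<close>
  define \<epsilon> where "\<epsilon> = e / (1 + (b - a) + \<bar>K\<bar>)"
  have pos: "1 + (b - a) + \<bar>K\<bar> > 0" using \<open>a \<le> b\<close> abs_ge_zero[of K] by simp
  then have "\<epsilon> > 0" using \<open>e > 0\<close> by (simp add: \<epsilon>_def)
  then obtain \<delta> where "\<delta> > 0" and \<delta>: "\<forall>D. finite D \<and> (\<forall>(u, v)\<in>D. a \<le> u \<and> u \<le> v \<and> v \<le> b) \<and>
        pairwise (\<lambda>(u, v) (u', v'). {u<..<v} \<inter> {u'<..<v'} = {}) D \<and>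
        (\<Sum>(u, v)\<in>D. v - u) < \<delta> \<longrightarrow> (\<Sum>(u, v)\<in>D. norm (f v - f u)) < \<epsilon>"
    using ac unfolding abs_continuous_on_interval_def by blast
  have Nnull: "N \<in> null_sets lebesgue" using N by (simp add: negligible_iff_null_sets)
  then have "N \<in> sets lebesgue" by auto
  moreover have "min \<delta> \<epsilon> > 0" using \<open>\<delta> > 0\<close> \<open>\<epsilon> > 0\<close> by simp
  \<comment> \<open>Measure below \<delta> makes absolute continuity applicable to the intervals
    tagged in \<open>N\<close>; measure below \<epsilon> bounds the length lost to the
    others.\<close>
  ultimately obtain U where U: "open U" "N \<subseteq> U" "U - N \<in> lmeasurable"
      "emeasure lebesgue (U - N) < ennreal (min \<delta> \<epsilon>)"
    by (rule sets_lebesgue_outer_open)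
  have "emeasure lebesgue U = emeasure lebesgue (U - N)"
    using emeasure_Diff_null_set[OF Nnull, of U] U(1) by simp
  with U(4) have "emeasure lebesgue U < ennreal (min \<delta> \<epsilon>)" by simp
  then have "U \<in> lmeasurable"
    using U(1) by (intro fmeasurableI) (auto intro: less_trans)
  moreover from this have "measure lebesgue U < min \<delta> \<epsilon>"
    using \<open>emeasure lebesgue U < ennreal (min \<delta> \<epsilon>)\<close>
    by (simp add: emeasure_eq_measure2 ennreal_less_iff)
  ultimately have Um: "U \<in> lmeasurable" "measure lebesgue U < min \<delta> \<epsilon>" .
  have "\<exists>\<rho>>0. \<forall>u v. a \<le> u \<longrightarrow> u \<le> t \<longrightarrow> t \<le> v \<longrightarrow> v \<le> b \<longrightarrow> t - u < \<rho> \<longrightarrow> v - t < \<rho> \<longrightarrow>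
      f v - f u \<le> (K + \<epsilon>) * (v - u)" if "t \<in> {a..b} - N" for t
    using straddle[of t \<epsilon>] that \<open>\<epsilon> > 0\<close> by blast
  then obtain \<rho> where \<rho>: "\<And>t. t \<in> {a..b} - N \<Longrightarrow> \<rho> t > 0"
    "\<And>t u v. t \<in> {a..b} - N \<Longrightarrow> a \<le> u \<Longrightarrow> u \<le> t \<Longrightarrow> t \<le> v \<Longrightarrow> v \<le> b \<Longrightarrow> t - u < \<rho> t \<Longrightarrow>
        v - t < \<rho> t \<Longrightarrow> f v - f u \<le> (K + \<epsilon>) * (v - u)"
    by metis
  \<comment> \<open>Fineness keeps an interval inside \<open>U\<close> if its tag is in
    \<open>N\<close>, and otherwise within the radius where the increment bound holds. The value
    \<open>UNIV\<close> is a default for points that never occur as tags.\<close>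
  define g where "g t = (if t \<in> N then U else if t \<in> {a..b} then ball t (\<rho> t) else UNIV)" for t
  have "gauge g" using U \<rho>(1) by (auto simp: g_def gauge_def)
  then obtain D where D: "D tagged_division_of {a..b}" "g fine D"
    by (rule fine_division_exists_real)
  note Dd = tagged_division_ofD[OF D(1)]
  have interval: "k = {Inf k..Sup k} \<and> a \<le> Inf k \<and> Inf k \<le> x \<and> x \<le> Sup k \<and> Sup k \<le> b
      \<and> measure lebesgue k = Sup k - Inf k" if xk: "(x, k) \<in> D" for x k
  proof -
    obtain u v where "k = {u..v}" using Dd(4)[OF xk] by (auto simp: box_real)
    then show ?thesis using Dd(2,3)[OF xk] by (auto simp: measure_completion)
  qed
  define D1 where "D1 = {(x, k) \<in> D. x \<in> N}"
  have fin: "finite D" "finite D1" using Dd(1) unfolding D1_def by (auto intro: rev_finite_subset)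
  have D1p: "D1 tagged_partial_division_of {a..b}"
    using tagged_partial_division_subset[of D "{a..b}" D1] D(1)
    by (auto simp: D1_def tagged_division_of_def)
  then have D1u: "D1 tagged_division_of \<Union>(snd ` D1)"
    by (rule tagged_partial_division_of_Union_self)
  have D1d: "(snd ` D1) division_of \<Union>(snd ` D1)"
    by (rule division_of_tagged_division[OF D1u])
  have nonempty: "k \<noteq> {}" if xk: "(x, k) \<in> D" for x k
    using Dd(2)[OF xk] by blast
  \<comment> \<open>Absolute continuity speaks of a set of endpoint pairs, whereas one interval may
    carry several tags in a tagged division. This happens only for degenerate intervals, so the sums
    agree for every \<open>h\<close> that vanishes on the diagonal.\<close>
  define E where "E = (\<lambda>k. (Inf k, Sup k)) ` snd ` D1"
  have inj: "inj_on (\<lambda>k. (Inf k, Sup k)) (snd ` D1)"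
    by (rule inj_onI) (use interval in \<open>auto simp: D1_def, metis+\<close>)
  have sumE: "(\<Sum>(x, k)\<in>D1. h (Inf k) (Sup k)) = (\<Sum>(u, v)\<in>E. h u v)"
    if "\<And>u. h u u = 0" for h :: "real \<Rightarrow> real \<Rightarrow> real"
  proof -
    let ?h = "\<lambda>k. if k = {} then 0 else h (Inf k) (Sup k)"
    have "(\<Sum>(x, k)\<in>D1. h (Inf k) (Sup k)) = (\<Sum>(x, k)\<in>D1. ?h k)"
      using nonempty by (intro sum.cong) (auto simp: D1_def)
    also have "\<dots> = (\<Sum>k\<in>snd ` D1. ?h k)"
    proof (rule sum.over_tagged_division_lemma[OF D1u])
      fix u v :: real assume "box u v = {}"
      then show "?h (cbox u v) = 0" by (cases "u = v") (auto simp: box_real that)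
    qed
    also have "\<dots> = (\<Sum>k\<in>snd ` D1. h (Inf k) (Sup k))"
      using nonempty by (intro sum.cong) (auto simp: D1_def)
    also have "\<dots> = (\<Sum>(u, v)\<in>E. h u v)"
      unfolding E_def using inj by (simp add: sum.reindex)
    finally show ?thesis .
  qed
  have "(\<Sum>(x, k)\<in>D1. Sup k - Inf k) = (\<Sum>(x, k)\<in>D1. measure lebesgue k)"
    using interval by (intro sum.cong) (auto simp: D1_def)
  also have "\<dots> = sum (measure lebesgue) (snd ` D1)"
    by (rule sum.over_tagged_division_lemma[OF D1u]) (simp add: measure_completion content_eq_0_interior)
  also have "\<dots> = measure lebesgue (\<Union>(snd ` D1))"
    using content_division[OF D1d] by simp
  also have "\<dots> \<le> measure lebesgue U"
  proof (rule measure_mono_fmeasurable[OF _ _ Um(1)])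
    show "\<Union>(snd ` D1) \<subseteq> U"
      using D(2) by (fastforce simp: D1_def fine_def g_def)
    show "\<Union>(snd ` D1) \<in> sets lebesgue"
      using lmeasurable_division[OF D1d] by auto
  qed
  finally have len: "(\<Sum>(x, k)\<in>D1. Sup k - Inf k) < min \<delta> \<epsilon>" using Um(2) by linarith
  have "(\<Sum>(u, v)\<in>E. norm (f v - f u)) < \<epsilon>"
  proof (rule \<delta>[rule_format], intro conjI)
    show "finite E" using fin by (simp add: E_def)
    show "\<forall>(u, v)\<in>E. a \<le> u \<and> u \<le> v \<and> v \<le> b"
      using interval unfolding E_def D1_def by fastforce
    show "(\<Sum>(u, v)\<in>E. v - u) < \<delta>"
      using len sumE[of "\<lambda>u v. v - u"] by simp
    show "pairwise (\<lambda>(u, v) (u', v'). {u<..<v} \<inter> {u'<..<v'} = {}) E"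
    proof -
      have "{Inf k<..<Sup k} \<inter> {Inf k'<..<Sup k'} = {}"
        if kk: "k \<in> snd ` D1" "k' \<in> snd ` D1" "k \<noteq> k'" for k k'
      proof -
        obtain x x' where "(x, k) \<in> D1" "(x', k') \<in> D1" using kk by force
        then have k: "(x, k) \<in> D" "(x', k') \<in> D" "(x, k) \<noteq> (x', k')"
          using kk(3) unfolding D1_def by blast+
        then have "k = {Inf k..Sup k}" "k' = {Inf k'..Sup k'}"
          using interval by blast+
        then have "interior k = {Inf k<..<Sup k}" "interior k' = {Inf k'<..<Sup k'}"
          using interior_atLeastAtMost_real by metis+
        then show ?thesis using Dd(5)[OF k] by simp
      qed
      then show ?thesis
        unfolding E_def by (intro pairwise_imageI) (simp only: prod.case simp_thms)
    qed
  qed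
  then have "(\<Sum>(x, k)\<in>D1. \<bar>f (Sup k) - f (Inf k)\<bar>) < \<epsilon>"
    using sumE[of "\<lambda>u v. \<bar>f v - f u\<bar>"] by simp
  moreover have "(\<Sum>(x, k)\<in>D1. f (Sup k) - f (Inf k)) \<le> (\<Sum>(x, k)\<in>D1. \<bar>f (Sup k) - f (Inf k)\<bar>)"
    by (intro sum_mono) auto
  ultimately have S1: "(\<Sum>(x, k)\<in>D1. f (Sup k) - f (Inf k)) < \<epsilon>" by linarith
  have "(\<Sum>(x, k)\<in>D - D1. f (Sup k) - f (Inf k)) \<le> (\<Sum>(x, k)\<in>D - D1. (K + \<epsilon>) * (Sup k - Inf k))"
  proof (intro sum_mono, clarify)
    fix x k assume xk: "(x, k) \<in> D" "(x, k) \<notin> D1"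
    then have x: "x \<in> {a..b} - N" using Dd(2,3)[OF xk(1)] by (auto simp: D1_def)
    then have "k \<subseteq> ball x (\<rho> x)"
      using D(2) xk(1) unfolding fine_def g_def by fastforce
    moreover have "Inf k \<in> k" "Sup k \<in> k"
      using interval[OF xk(1)] by (metis atLeastAtMost_iff order_refl order_trans)+
    ultimately have "x - Inf k < \<rho> x" "Sup k - x < \<rho> x"
      by (auto simp: dist_real_def subset_iff)
    then show "f (Sup k) - f (Inf k) \<le> (K + \<epsilon>) * (Sup k - Inf k)"
      using \<rho>(2)[OF x] interval[OF xk(1)] by blast
  qed
  also have "\<dots> = (K + \<epsilon>) * (\<Sum>(x, k)\<in>D - D1. Sup k - Inf k)"
    by (simp add: sum_distrib_left case_prod_unfold)
  also have "(\<Sum>(x, k)\<in>D - D1. Sup k - Inf k) = (b - a) - (\<Sum>(x, k)\<in>D1. Sup k - Inf k)"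
    using additive_tagged_division_1[OF \<open>a \<le> b\<close> D(1), of "\<lambda>x. x"] fin
    by (subst sum_diff) (auto simp: D1_def)
  finally have S2: "(\<Sum>(x, k)\<in>D - D1. f (Sup k) - f (Inf k))
      \<le> (K + \<epsilon>) * ((b - a) - (\<Sum>(x, k)\<in>D1. Sup k - Inf k))" .
  let ?l = "\<Sum>(x, k)\<in>D1. Sup k - Inf k"
  have l0: "0 \<le> ?l" using interval by (intro sum_nonneg) (fastforce simp: D1_def)
  have "f b - f a = (\<Sum>(x, k)\<in>D. f (Sup k) - f (Inf k))"
    using additive_tagged_division_1[OF \<open>a \<le> b\<close> D(1), of f] by simp
  also have "\<dots> = (\<Sum>(x, k)\<in>D - D1. f (Sup k) - f (Inf k)) + (\<Sum>(x, k)\<in>D1. f (Sup k) - f (Inf k))"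
    using fin by (subst sum.subset_diff[of D1 D]) (auto simp: D1_def)
  also have "\<dots> \<le> (K + \<epsilon>) * ((b - a) - ?l) + \<epsilon>" using S1 S2 by linarith
  also have "\<dots> = K * (b - a) + \<epsilon> * (b - a) - \<epsilon> * ?l - K * ?l + \<epsilon>" by (simp add: algebra_simps)
  also have "\<dots> \<le> K * (b - a) + \<epsilon> * (b - a) + \<bar>K\<bar> * \<epsilon> + \<epsilon>"
  proof -
    \<comment> \<open>\<open>K\<close> may have either sign; for negative \<open>K\<close> the
      omitted length \<open>?l\<close> would have contributed to the decrease.\<close>
    have "- (K * ?l) \<le> \<bar>K * ?l\<bar>" by (rule abs_ge_minus_self)
    also have "\<dots> = \<bar>K\<bar> * ?l" using l0 by (simp only: abs_mult abs_of_nonneg)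
    also have "\<dots> \<le> \<bar>K\<bar> * \<epsilon>" using len by (intro mult_left_mono) auto
    finally show ?thesis using mult_nonneg_nonneg[of \<epsilon> ?l] l0 \<open>\<epsilon> > 0\<close> by linarith
  qed
  also have "\<dots> = K * (b - a) + \<epsilon> * (1 + (b - a) + \<bar>K\<bar>)"
    by (simp add: algebra_simps)
  also have "\<dots> = K * (b - a) + e" using pos by (simp add: \<epsilon>_def)
  finally show "f b - f a \<le> K * (b - a) + e" .
qed

text \<open>Away from zero the norm has derivative sgn (q t) \<bullet> w; at a zero of q the
  assumption w = 0 gives derivative 0. The errors of the linear approximations from u to t and from
  t to v add up to \<epsilon> (v - u) because t lies between u and v.\<close>

lemma vector_derivative_straddle_norm:
  fixes q :: "real \<Rightarrow> 'a::real_inner"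
  assumes q: "(q has_vector_derivative w) (at t within S)"
    and "q t \<noteq> 0 \<Longrightarrow> sgn (q t) \<bullet> w \<le> K" "q t = 0 \<Longrightarrow> w = 0 \<and> 0 \<le> K" and "\<epsilon> > 0"
  obtains \<delta> where "\<delta> > 0" "\<And>u v. u \<in> S \<Longrightarrow> v \<in> S \<Longrightarrow> u \<le> t \<Longrightarrow> t \<le> v \<Longrightarrow> t - u < \<delta> \<Longrightarrow> v - t < \<delta> \<Longrightarrow>
    norm (q v) - norm (q u) \<le> (K + \<epsilon>) * (v - u)"
proof -
  obtain D where D: "((\<lambda>s. norm (q s)) has_real_derivative D) (at t within S)" "D \<le> K"
  proof (cases "q t = 0")
    case True
    then have "w = 0" "0 \<le> K" using assms by auto
    then have "(q has_derivative (\<lambda>_. 0)) (at t within S)"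
      using q by (simp add: has_vector_derivative_def)
    then have "((\<lambda>s. norm (q s)) has_derivative (\<lambda>_. 0)) (at t within S)"
      using True by (simp add: has_derivative_within_alt)
    then show ?thesis using that[of 0] \<open>0 \<le> K\<close> by (simp add: has_field_derivative_def lambda_zero)
  next
    case False
    have "((\<lambda>s. norm (q s)) has_derivative (\<lambda>h. sgn (q t) \<bullet> (h *\<^sub>R w))) (at t within S)"
      using has_derivative_compose[OF q[unfolded has_vector_derivative_def] has_derivative_norm[OF False]]
      by (simp add: inner_commute)
    then show ?thesis
      using that[of "sgn (q t) \<bullet> w"] assms(2) False
      by (simp add: has_field_derivative_def mult.commute[of "sgn (q t) \<bullet> w"] fun_eq_iff mult_commute_abs)
  qed
  obtain \<delta> where "\<delta> > 0" and \<delta>: "\<forall>y\<in>S. norm (y - t) < \<delta> \<longrightarrow>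
      norm (norm (q y) - norm (q t) - D * (y - t)) \<le> \<epsilon> * norm (y - t)"
    using D(1) \<open>\<epsilon> > 0\<close> unfolding has_field_derivative_def has_derivative_within_alt by blast
  show ?thesis
  proof (rule that[OF \<open>\<delta> > 0\<close>])
    fix u v assume uv: "u \<in> S" "v \<in> S" "u \<le> t" "t \<le> v" "t - u < \<delta>" "v - t < \<delta>"
    have "norm (norm (q u) - norm (q t) - D * (u - t)) \<le> \<epsilon> * norm (u - t)"
      using \<delta> uv by auto
    moreover have "norm (norm (q v) - norm (q t) - D * (v - t)) \<le> \<epsilon> * norm (v - t)"
      using \<delta> uv by auto
    ultimately have "norm (q v) - norm (q u) \<le> D * (v - u) + \<epsilon> * (v - u)"
      using uv by (simp add: algebra_simps abs_le_iff)
    also have "\<dots> \<le> (K + \<epsilon>) * (v - u)"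
      using D(2) uv by (simp add: distrib_right mult_right_mono)
    finally show "norm (q v) - norm (q u) \<le> (K + \<epsilon>) * (v - u)" .
  qed
qed

section \<open>Distances along a trajectory\<close>

lemma trajectory_abs_continuous_difference:
  assumes "trajectory V \<sigma> p" "0 \<le> a"
  shows "abs_continuous_on_interval (\<lambda>t. p t i - p t j) a b"
proof (cases "0 \<le> b")
  case True
  have "abs_continuous_on_interval (\<lambda>t. p t i - p t j) 0 b"
    using assms(1) True by (intro abs_continuous_on_interval_diff) (auto simp: trajectory_def)
  then show ?thesis
    by (rule abs_continuous_on_interval_diff_le) (use assms in auto)
next
  case False
  have "abs_continuous_on_interval (\<lambda>t. p t i - p t j) 0 0"
    using assms(1) by (intro abs_continuous_on_interval_diff) (auto simp: trajectory_def)
  then have "abs_continuous_on_interval (\<lambda>t. p t i - p t j) 0 b"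
    by (rule abs_continuous_on_interval_diff_le) (use False in auto)
  then show ?thesis
    by (rule abs_continuous_on_interval_diff_le) (use assms in auto)
qed

text \<open>With finitely many agents, their exceptional times fit into one common null set.\<close>

lemma trajectory_derivative_off_null_set:
  assumes "trajectory V \<sigma> p"
  obtains N where "negligible N" "\<And>t i. 0 \<le> t \<Longrightarrow> t \<notin> N \<Longrightarrow>
    ((\<lambda>s. p s i) has_vector_derivative velocity V \<sigma> (p t) i) (at t within {0..})"
proof -
  have "AE t in lebesgue. \<forall>i\<in>UNIV. 0 \<le> t \<longrightarrow>
      ((\<lambda>s. p s i) has_vector_derivative velocity V \<sigma> (p t) i) (at t within {0..})"
    using assms by (intro AE_finite_allI) (auto simp: trajectory_def)
  then obtain N where "N \<in> null_sets lebesgue" "{t \<in> space lebesgue. \<not> (\<forall>i\<in>UNIV. 0 \<le> t \<longrightarrow>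
      ((\<lambda>s. p s i) has_vector_derivative velocity V \<sigma> (p t) i) (at t within {0..}))} \<subseteq> N"
    unfolding eventually_ae_filter by blast
  then show ?thesis
    using that[of N] by (auto simp: negligible_iff_null_sets)
qed

text \<open>Neither agent's motion increases the distance while the two are neighbours, so the
  increment bound applies with K = 0. That they remain neighbours is assumed here and removed in
  \<open>trajectory_dist_antimono\<close>.\<close>

lemma trajectory_dist_le_if_near:
  fixes p :: "real \<Rightarrow> 'n::finite \<Rightarrow> real^2"
  assumes traj: "trajectory V \<sigma> p" and "V > 0" "\<sigma> > 0" "0 \<le> a" "a \<le> b" "i \<noteq> j"
    and near: "\<And>t. a \<le> t \<Longrightarrow> t \<le> b \<Longrightarrow> norm (p t i - p t j) < V"
  shows "norm (p b i - p b j) \<le> norm (p a i - p a j)"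
proof -
  let ?q = "\<lambda>t. p t i - p t j"
  obtain N where N: "negligible N" "\<And>t i. 0 \<le> t \<Longrightarrow> t \<notin> N \<Longrightarrow>
      ((\<lambda>s. p s i) has_vector_derivative velocity V \<sigma> (p t) i) (at t within {0..})"
    using trajectory_derivative_off_null_set[OF traj] by blast
  have "norm (?q b) - norm (?q a) \<le> 0 * (b - a)"
  proof (rule abs_continuous_increment_le[OF _ \<open>a \<le> b\<close> N(1)])
    show "abs_continuous_on_interval (\<lambda>t. norm (?q t)) a b"
      by (rule abs_continuous_on_interval_diff_le[OF trajectory_abs_continuous_difference[OF traj \<open>0 \<le> a\<close>]])
        (auto intro: norm_triangle_ineq3)
    fix t \<epsilon> :: real
    assume t: "t \<in> {a..b}" "t \<notin> N" and "\<epsilon> > 0"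
    let ?w = "velocity V \<sigma> (p t) i - velocity V \<sigma> (p t) j"
    have "(?q has_vector_derivative ?w) (at t within {0..})"
      using t \<open>0 \<le> a\<close> by (intro has_vector_derivative_diff N(2)) auto
    moreover have "sgn (?q t) \<bullet> ?w \<le> 0"
    proof -
      have nb: "j \<in> neighbours V (p t) i" "i \<in> neighbours V (p t) j"
        using near[of t] t \<open>i \<noteq> j\<close> by (auto simp: neighbours_def norm_minus_commute)
      have "?q t \<bullet> ?w \<le> 0"
        using velocity_inner_nonneg[OF _ nb(1), of \<sigma>] velocity_inner_nonneg[OF _ nb(2), of \<sigma>] \<open>\<sigma> > 0\<close>
        by (simp add: inner_diff_left inner_diff_right inner_commute)
      then show ?thesis by (simp add: sgn_div_norm mult_nonneg_nonpos)
    qed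
    moreover have "?q t = 0 \<Longrightarrow> ?w = 0 \<and> (0::real) \<le> 0"
      using velocity_collocated[of "p t" i j V \<sigma>] \<open>V > 0\<close> by simp
    ultimately obtain \<delta> where "\<delta> > 0" "\<And>u v. u \<in> {0..} \<Longrightarrow> v \<in> {0..} \<Longrightarrow> u \<le> t \<Longrightarrow> t \<le> v \<Longrightarrow>
        t - u < \<delta> \<Longrightarrow> v - t < \<delta> \<Longrightarrow> norm (?q v) - norm (?q u) \<le> (0 + \<epsilon>) * (v - u)"
      using vector_derivative_straddle_norm[of ?q ?w t "{0..}" 0 \<epsilon>] \<open>\<epsilon> > 0\<close> by blast
    then show "\<exists>\<delta>>0. \<forall>u v. a \<le> u \<longrightarrow> u \<le> t \<longrightarrow> t \<le> v \<longrightarrow> v \<le> b \<longrightarrow> t - u < \<delta> \<longrightarrow> v - t < \<delta> \<longrightarrow>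
        norm (?q v) - norm (?q u) \<le> (0 + \<epsilon>) * (v - u)"
      using \<open>0 \<le> a\<close> by (intro exI[of _ \<delta>]) auto
  qed
  then show ?thesis by simp
qed

text \<open>A distance that grew would attain some level m strictly between its initial value and V.
  Until the first such time it stays below V, by the intermediate value theorem, so the pair is in
  range throughout and cannot have reached m.\<close>

lemma trajectory_dist_antimono:
  fixes p :: "real \<Rightarrow> 'n::finite \<Rightarrow> real^2"
  assumes traj: "trajectory V \<sigma> p" and "V > 0" "\<sigma> > 0" "0 \<le> a" "a \<le> b"
    and near: "norm (p a i - p a j) < V"
  shows "norm (p b i - p b j) \<le> norm (p a i - p a j)"
proof (cases "i = j")
  case False
  let ?d = "\<lambda>t. norm (p t i - p t j)"
  have cont: "continuous_on {a..b} ?d"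
    by (intro continuous_on_norm abs_continuous_on_interval_imp_continuous_on
        trajectory_abs_continuous_difference[OF traj \<open>0 \<le> a\<close>])
  show ?thesis
  proof (rule ccontr)
    assume "\<not> ?thesis"
    then have "?d a < min V (?d b)" using near by simp
    then obtain m where m: "?d a < m" "m < V" "m < ?d b"
      using dense by (metis min_less_iff_conj)
    let ?A = "{a..b} \<inter> ?d -` {m}"
    have reach: "\<exists>s\<ge>a. s \<le> t \<and> ?d s = m" if "a \<le> t" "t \<le> b" "m \<le> ?d t" for t
      using IVT'[of ?d a m t] m that continuous_on_subset[OF cont, of "{a..t}"] by auto
    have "compact ?A"
      using continuous_closed_preimage[OF cont closed_atLeastAtMost closed_singleton]
      unfolding compact_eq_bounded_closed
      by (auto intro: bounded_subset[OF bounded_closed_interval])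
    moreover have "?A \<noteq> {}"
      using reach[of b] m \<open>a \<le> b\<close> by auto
    ultimately obtain \<tau> where \<tau>: "\<tau> \<in> ?A" "\<And>s. s \<in> ?A \<Longrightarrow> \<tau> \<le> s"
      using compact_attains_inf[of ?A] by blast
    have "?d t < V" if t: "a \<le> t" "t \<le> \<tau>" for t
    proof (rule ccontr)
      assume far: "\<not> ?thesis"
      then obtain s where "a \<le> s" "s \<le> t" "?d s = m"
        using reach[of t] t \<tau>(1) m by auto
      then have "t = \<tau>" using \<tau>(2)[of s] \<tau>(1) t by auto
      then show False using far \<tau>(1) m by auto
    qed
    then have "?d \<tau> \<le> ?d a"
      using \<tau>(1) False assms by (intro trajectory_dist_le_if_near[OF traj]) auto
    then show False using \<tau>(1) m by auto
  qed
qed simp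

lemma trajectory_connected:
  fixes p :: "real \<Rightarrow> 'n::finite \<Rightarrow> real^2"
  assumes "trajectory V \<sigma> p" "V > 0" "\<sigma> > 0" "neighbourhood_connected V (p 0)" "0 \<le> t"
  shows "neighbourhood_connected V (p t)"
proof -
  have "neighbourhood_edges V (p 0) \<subseteq> neighbourhood_edges V (p t)"
    using trajectory_dist_antimono[OF assms(1-3) order_refl assms(5)]
    by (fastforce simp: neighbourhood_edges_def neighbours_def)
  then show ?thesis
    using assms(4) rtrancl_mono unfolding neighbourhood_connected_def by blast
qed

section \<open>Decrease of the truncated distances\<close>

text \<open>Truncation at \<open>V\<close> turns the appearance of a new edge into a continuous event.\<close>

definition truncated_dist_sum :: "real \<Rightarrow> ('n::finite \<Rightarrow> real^2) \<Rightarrow> real" where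
  "truncated_dist_sum V c = (\<Sum>(i, j)\<in>UNIV. min V (norm (c i - c j)))"

text \<open>Agents out of range may recede from each other, but their truncated distance already has
  its greatest value V.\<close>

lemma trajectory_truncated_dist_antimono:
  fixes p :: "real \<Rightarrow> 'n::finite \<Rightarrow> real^2"
  assumes "trajectory V \<sigma> p" "V > 0" "\<sigma> > 0" "0 \<le> a" "a \<le> b"
  shows "min V (norm (p b i - p b j)) \<le> min V (norm (p a i - p a j))"
proof (cases "norm (p a i - p a j) < V")
  case True
  then show ?thesis using trajectory_dist_antimono[OF assms True] by (intro min.mono) auto
qed simp

text \<open>The agents \<open>s\<close> and \<open>r\<close> are chosen anew for each t. Their
  distance is positive and below V at time t, so it is differentiable there and the truncation is
  inactive nearby.\<close>

lemma trajectory_truncated_dist_sum_straddle: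
  fixes p :: "real \<Rightarrow> 'n::finite \<Rightarrow> real^2"
  defines "\<kappa> \<equiv> cos ((pi - pi / (CARD('n) + 1)) / 2)"
  assumes traj: "trajectory V \<sigma> p" and "V > 0" "\<sigma> > 0"
    and conn: "neighbourhood_connected V (p t)" and sep: "\<not> (\<exists>q. \<forall>i. p t i = q)"
    and der: "\<And>i. ((\<lambda>s. p s i) has_vector_derivative velocity V \<sigma> (p t) i) (at t within {0..})"
    and "0 \<le> t" "\<epsilon> > 0"
  shows "\<exists>\<delta>>0. \<forall>u v. 0 \<le> u \<longrightarrow> u \<le> t \<longrightarrow> t \<le> v \<longrightarrow> t - u < \<delta> \<longrightarrow> v - t < \<delta> \<longrightarrow>
    truncated_dist_sum V (p v) - truncated_dist_sum V (p u) \<le> (- \<sigma> * \<kappa> + \<epsilon>) * (v - u)"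
proof -
  obtain s r where r: "r \<in> visible V (p t) s"
    "velocity V \<sigma> (p t) s \<bullet> bearing (p t) s r \<ge> \<sigma> * \<kappa>"
    using ex_fast_agent[OF conn sep \<open>\<sigma> > 0\<close>] unfolding \<kappa>_def by blast
  let ?q = "\<lambda>t. p t s - p t r" and ?w = "velocity V \<sigma> (p t) s - velocity V \<sigma> (p t) r"
  have q: "?q t \<noteq> 0" "norm (?q t) < V" "s \<noteq> r"
    using r(1) by (auto simp: visible_def neighbours_def)
  have dq: "(?q has_vector_derivative ?w) (at t within {0..})"
    by (intro has_vector_derivative_diff der)
  have "s \<in> neighbours V (p t) r"
    using r(1) neighbours_sym by (auto simp: visible_def)
  \<comment> \<open>The motion of \<open>r\<close> can only help: \<open>s\<close> is also a
    neighbour of \<open>r\<close>.\<close>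
  then have "0 \<le> velocity V \<sigma> (p t) r \<bullet> ?q t"
    using velocity_inner_nonneg \<open>\<sigma> > 0\<close> by (metis less_imp_le)
  then have "0 \<le> sgn (?q t) \<bullet> velocity V \<sigma> (p t) r"
    by (simp add: sgn_div_norm inner_commute)
  moreover have "sgn (?q t) = - bearing (p t) s r"
    unfolding bearing_def by (metis minus_diff_eq sgn_minus)
  ultimately have "sgn (?q t) \<bullet> ?w \<le> - \<sigma> * \<kappa>"
    using r(2) by (simp add: inner_diff_right inner_commute)
  then obtain \<delta>1 where \<delta>1: "\<delta>1 > 0" "\<And>u v. u \<in> {0..} \<Longrightarrow> v \<in> {0..} \<Longrightarrow> u \<le> t \<Longrightarrow> t \<le> v \<Longrightarrow>
      t - u < \<delta>1 \<Longrightarrow> v - t < \<delta>1 \<Longrightarrow> norm (?q v) - norm (?q u) \<le> (- \<sigma> * \<kappa> + \<epsilon>) * (v - u)"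
    using vector_derivative_straddle_norm[OF dq _ _ \<open>\<epsilon> > 0\<close>, of "- \<sigma> * \<kappa>"] q(1) by blast
  have "continuous (at t within {0..}) ?q"
    using dq by (rule has_vector_derivative_continuous)
  then have "continuous (at t within {0..}) (\<lambda>t. norm (?q t))"
    by (rule continuous_norm)
  moreover have "V - norm (?q t) > 0" using q by simp
  ultimately obtain \<delta>2 where \<delta>2: "\<delta>2 > 0"
    "\<forall>y\<in>{0..}. dist y t < \<delta>2 \<longrightarrow> dist (norm (?q y)) (norm (?q t)) < V - norm (?q t)"
    unfolding continuous_within_eps_delta by blast
  have close: "norm (?q y) < V" if "0 \<le> y" "\<bar>y - t\<bar> < \<delta>2" for y
  proof -
    have "dist (norm (?q y)) (norm (?q t)) < V - norm (?q t)"
      using \<delta>2(2) that by (auto simp: dist_real_def)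
    then show ?thesis unfolding dist_real_def by linarith
  qed
  show ?thesis
  proof (intro exI[of _ "min \<delta>1 \<delta>2"] conjI allI impI)
    fix u v assume uv: "0 \<le> u" "u \<le> t" "t \<le> v" "t - u < min \<delta>1 \<delta>2" "v - t < min \<delta>1 \<delta>2"
    let ?g = "\<lambda>(i, j). min V (norm (p v i - p v j)) - min V (norm (p u i - p u j))"
    have "truncated_dist_sum V (p v) - truncated_dist_sum V (p u) = sum ?g UNIV"
      by (simp add: truncated_dist_sum_def sum_subtractf[symmetric] case_prod_unfold)
    also have "\<dots> = ?g (s, r) + sum ?g (UNIV - {(s, r)})"
      \<comment> \<open>The ordered pair (s, r) alone supplies the rate; for all others, including
        (r, s), it is enough that they do not increase.\<close>
      by (rule sum.remove) auto
    also have "sum ?g (UNIV - {(s, r)}) \<le> 0"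
      using trajectory_truncated_dist_antimono[OF traj \<open>V > 0\<close> \<open>\<sigma> > 0\<close> uv(1), of v] uv
      by (intro sum_nonpos) auto
    also have "?g (s, r) = norm (?q v) - norm (?q u)"
      using close[of u] close[of v] uv by auto
    also have "\<dots> \<le> (- \<sigma> * \<kappa> + \<epsilon>) * (v - u)"
      using uv by (intro \<delta>1(2)) auto
    finally show "truncated_dist_sum V (p v) - truncated_dist_sum V (p u) \<le> (- \<sigma> * \<kappa> + \<epsilon>) * (v - u)"
      by simp
  qed (use \<delta>1 \<delta>2 in auto)
qed

theorem theorem8:
  fixes p :: "real \<Rightarrow> 'n::finite \<Rightarrow> real^2" and V \<sigma> :: real
  assumes "V > 0" and "\<sigma> > 0"
    and "trajectory V \<sigma> p"
    and "neighbourhood_connected V (p 0)"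
  shows "\<exists>T\<ge>0. \<exists>q. \<forall>i. p T i = q"
proof (rule ccontr)
  assume "\<not> ?thesis"
  then have sep: "\<not> (\<exists>q. \<forall>i. p t i = q)" if "0 \<le> t" for t using that by blast
  \<comment> \<open>This is sin (pi / (2 (n + 1))), which is positive.\<close>
  define \<kappa> where "\<kappa> = cos ((pi - pi / (CARD('n) + 1)) / 2)"
  let ?F = "\<lambda>t. truncated_dist_sum V (p t)"
  have "pi / (CARD('n) + 1) > 0" by (simp add: add_pos_pos)
  moreover have "pi / (CARD('n) + 1) \<le> pi / 1"
    by (intro divide_left_mono) auto
  ultimately have "- (pi / 2) < (pi - pi / (CARD('n) + 1)) / 2"
    "(pi - pi / (CARD('n) + 1)) / 2 < pi / 2"
    using pi_gt_zero by argo+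
  then have "0 < \<kappa>"
    unfolding \<kappa>_def by (rule cos_gt_zero_pi)
  then have "\<sigma> * \<kappa> > 0" using \<open>\<sigma> > 0\<close> by simp
  have F0: "0 \<le> ?F t" for t
    using \<open>V > 0\<close> unfolding truncated_dist_sum_def by (intro sum_nonneg) auto
  \<comment> \<open>At rate \<sigma> \<kappa> the sum would fall by its initial value plus 1, hence
    to at most -1, by time T.\<close>
  define T where "T = (?F 0 + 1) / (\<sigma> * \<kappa>)"
  have "0 \<le> T" using F0[of 0] \<open>\<sigma> * \<kappa> > 0\<close> by (simp add: T_def)
  obtain N where N: "negligible N" "\<And>t i. 0 \<le> t \<Longrightarrow> t \<notin> N \<Longrightarrow>
      ((\<lambda>s. p s i) has_vector_derivative velocity V \<sigma> (p t) i) (at t within {0..})"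
    using trajectory_derivative_off_null_set[OF assms(3)] by blast
  have "?F T - ?F 0 \<le> (- \<sigma> * \<kappa>) * (T - 0)"
  proof (rule abs_continuous_increment_le[OF _ \<open>0 \<le> T\<close> N(1)])
    have "abs_continuous_on_interval (\<lambda>t. min V (norm (p t i - p t j))) 0 T" for i j
    proof (rule abs_continuous_on_interval_diff_le)
      show "abs_continuous_on_interval (\<lambda>t. p t i - p t j) 0 T"
        by (rule trajectory_abs_continuous_difference[OF assms(3) order_refl])
      fix u v
      have "\<bar>min V (norm x) - min V (norm y)\<bar> \<le> norm (x - y)" for x y :: "real^2"
        using norm_triangle_ineq3[of x y] by linarith
      then show "norm (min V (norm (p v i - p v j)) - min V (norm (p u i - p u j)))
          \<le> norm (p v i - p v j - (p u i - p u j))"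
        unfolding real_norm_def .
    qed simp_all
    then show "abs_continuous_on_interval ?F 0 T"
      unfolding truncated_dist_sum_def case_prod_unfold by (intro abs_continuous_on_interval_sum)
    fix t \<epsilon> :: real
    assume t: "t \<in> {0..T}" "t \<notin> N" and "\<epsilon> > 0"
    have "neighbourhood_connected V (p t)"
      using trajectory_connected[OF assms(3,1,2,4)] t by simp
    then obtain \<delta> where "\<delta> > 0" "\<forall>u v. 0 \<le> u \<longrightarrow> u \<le> t \<longrightarrow> t \<le> v \<longrightarrow> t - u < \<delta> \<longrightarrow> v - t < \<delta> \<longrightarrow>
        ?F v - ?F u \<le> (- \<sigma> * \<kappa> + \<epsilon>) * (v - u)"
      using trajectory_truncated_dist_sum_straddle[OF assms(3,1,2) _ sep N(2) _ \<open>\<epsilon> > 0\<close>, of t] t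
      unfolding \<kappa>_def by auto
    then show "\<exists>\<delta>>0. \<forall>u v. 0 \<le> u \<longrightarrow> u \<le> t \<longrightarrow> t \<le> v \<longrightarrow> v \<le> T \<longrightarrow> t - u < \<delta> \<longrightarrow> v - t < \<delta> \<longrightarrow>
        ?F v - ?F u \<le> (- \<sigma> * \<kappa> + \<epsilon>) * (v - u)"
      by (intro exI[of _ \<delta>]) auto
  qed
  also have "\<dots> = - (?F 0 + 1)"
    using \<open>\<sigma> > 0\<close> \<open>0 < \<kappa>\<close> by (simp add: T_def)
  finally show False using F0[of T] by simp
qed

end
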